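(* Let $G$ and $H$ be finite simple graphs, let $G+H$ be their join, and let $c\in[0,1]$. Then $$\mathrm{vol}(G+H,c)=\int_0^c\int_0^c\Big(\frac{d}{ds}\mathrm{vol}(G,s)\Big)\Big(\frac{d}{dt}\mathrm{vol}(H,t)\Big)K(s,t)\,ds\,dt.$$
   Context: All graphs have a nonempty finite vertex set. $K:[0,1]^2\to\mathbb{R}$ is defined by $K(s,t)=1$ if $s+t\le1$ and $K(s,t)=0$ otherwise. For a finite simple graph $G=([n],EG)$ and $a\in[0,1]$, the sliced volume is $\mathrm{vol}(G,a)=\int_{[0,a]^n}\prod_{ij\in EG}K(x_i,x_j)\,dx$ (an empty product equals $1$); derivatives at the endpoints of $[0,1]$ are one-sided. The join $G+H$ of graphs $G$ and $H$ (with disjoint vertex sets) is the graph with vertex set $VG\cup VH$ and edge set $EG\cup EH\cup\{xy : x\in VG,\ y\in VH\}$. *)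

theory Defs
  imports "HOL-Analysis.Analysis"
begin

record 'a graph =
  verts :: "'a set"
  edges :: "'a set set"

definition simple_graph :: "'a graph \<Rightarrow> bool" where
  "simple_graph G \<longleftrightarrow> finite (verts G) \<and> verts G \<noteq> {} \<and>
     (\<forall>e\<in>edges G. e \<subseteq> verts G \<and> card e = 2)"

text \<open>The join is only meant to be used for graphs with disjoint vertex sets.\<close>

definition graph_join :: "'a graph \<Rightarrow> 'a graph \<Rightarrow> 'a graph" where
  "graph_join G H =
     \<lparr>verts = verts G \<union> verts H,
      edges = edges G \<union> edges H \<union> {{x, y} | x y. x \<in> verts G \<and> y \<in> verts H}\<rparr>"

text \<open>The kernel lives on the unit square; the formula extends it to the plane, but it is
  only ever integrated over subsets of powers of the unit interval.\<close>

definition K :: "real \<Rightarrow> real \<Rightarrow> real" where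
  "K s t = (if s + t \<le> 1 then 1 else 0)"

lemma K_commute: "K s t = K t s"
  by (simp add: K_def add.commute)

text \<open>The factor \<open>K (x i) (x j)\<close> of an unordered edge; it is well defined because the kernel
  is symmetric.\<close>

definition edge_K :: "('a \<Rightarrow> real) \<Rightarrow> 'a set \<Rightarrow> real" where
  "edge_K x e = (THE r. \<exists>i j. e = {i, j} \<and> r = K (x i) (x j))"

lemma edge_K_pair: "edge_K x {i, j} = K (x i) (x j)"
  unfolding edge_K_def by (rule the_equality) (auto simp: doubleton_eq_iff K_commute)

text \<open>The coordinates are indexed by the vertices themselves rather than by a numbering of
  them, so that the sliced volume applies directly to a join.\<close>

definition vol :: "'a graph \<Rightarrow> real \<Rightarrow> real" where
  "vol G a =
     (LINT x:(Pi\<^sub>E (verts G) (\<lambda>_. {0..a}))|Pi\<^sub>M (verts G) (\<lambda>_. lborel).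
        (\<Prod>e\<in>edges G. edge_K x e))"

text \<open>Differentiating within the unit interval gives the ordinary derivative at interior
  points and the one-sided derivatives at 0 and 1.\<close>

definition vol_deriv :: "'a graph \<Rightarrow> real \<Rightarrow> real" where
  "vol_deriv G s = vector_derivative (vol G) (at s within {0..1})"

end

theory Submission
  imports Defs
begin

text \<open>Since the kernel is antitone, all edges between the two sides of a join are satisfied as
  soon as the one joining the largest coordinate of each side is. So the volume of the join is the
  integral of \<open>K\<close> against the product of the laws of the largest coordinates, and the law
  for \<open>G\<close> has distribution function \<open>vol G\<close>. It remains to see that this law has density
  \<open>vol_deriv G\<close>: \<open>vol G\<close> is continuous, and polynomial on each of \<open>[0, 1/2]\<close> and
  \<open>[1/2, 1]\<close>.\<close>

section \<open>Admissible configurations\<close>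

text \<open>The density is the delicate point. \<open>vol G\<close> is monotone, but a continuous
  monotone function can be singular, so that integrating its derivative need not give it back. The
  piecewise polynomial form excludes this: the fundamental theorem of calculus applies with one
  exceptional point. That point is 1/2 because a constraint s + t <= 1 can fail inside [0, a] only
  when a > 1/2. Volumes and laws are compared as \<open>ennreal\<close> values, so splitting,
  rescaling and iterated integration raise no integrability questions. Real integrals return only in
  the theorem, where \<open>vol_deriv\<close>, whose values at 0, 1/2 and 1 are not tracked, is
  exchanged for a nonnegative Borel density.\<close>

text \<open>The range \<open>A\<close> is left free because the splitting of the volume also needs
  the half-open ranges \<open>{1-a<..a}\<close> and \<open>{0<..1}\<close>.\<close>

definition pack :: "'a graph \<Rightarrow> real set \<Rightarrow> ('a \<Rightarrow> real) set" where
  "pack G A = {x \<in> verts G \<rightarrow>\<^sub>E A. \<forall>i\<in>verts G. \<forall>j\<in>verts G. {i, j} \<in> edges G \<longrightarrow> x i + x j \<le> 1}"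

abbreviation leb_power :: "'a set \<Rightarrow> ('a \<Rightarrow> real) measure" where
  "leb_power I \<equiv> Pi\<^sub>M I (\<lambda>_. lborel)"

interpretation lborel_power: product_sigma_finite "\<lambda>_. lborel :: real measure"
  by unfold_locales

lemma sigma_finite_leb_power:
  assumes "finite I"
  shows "sigma_finite_measure (leb_power I)"
  using lborel_power.sigma_finite[OF assms] .

lemma space_leb_power: "space (leb_power I) = I \<rightarrow>\<^sub>E UNIV"
  by (simp add: space_PiM)

lemma pack_mono: "A \<subseteq> B \<Longrightarrow> pack G A \<subseteq> pack G B"
  unfolding pack_def by (auto simp: PiE_iff)

lemma sets_pack [measurable]:
  assumes "finite (verts G)" "A \<in> sets borel"
  shows "pack G A \<in> sets (leb_power (verts G))"
proof -
  have [measurable]: "A \<in> sets borel" by fact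
  have "pack G A = {x \<in> space (leb_power (verts G)). (\<forall>i\<in>verts G. x i \<in> A) \<and>
      (\<forall>i\<in>verts G. \<forall>j\<in>verts G. {i, j} \<in> edges G \<longrightarrow> x i + x j \<le> 1)}"
    by (auto simp: pack_def space_leb_power PiE_iff)
  also have "\<dots> \<in> sets (leb_power (verts G))"
    using assms(1) by measurable
  finally show ?thesis .
qed

lemma emeasure_pack_le:
  assumes "finite (verts G)" "a \<ge> 0"
  shows "emeasure (leb_power (verts G)) (pack G {0..a}) \<le> ennreal (a ^ card (verts G))"
proof -
  have "emeasure (leb_power (verts G)) (pack G {0..a}) \<le> emeasure (leb_power (verts G)) (verts G \<rightarrow>\<^sub>E {0..a})"
    using assms by (intro emeasure_mono sets_PiM_I_finite) (auto simp: pack_def)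
  also have "\<dots> = ennreal (a ^ card (verts G))"
    using assms by (simp add: lborel_power.emeasure_PiM ennreal_power)
  finally show ?thesis .
qed

lemma emeasure_pack_finite:
  assumes "finite (verts G)"
  shows "emeasure (leb_power (verts G)) (pack G {0..a}) < \<infinity>"
proof -
  have "emeasure (leb_power (verts G)) (pack G {0..a})
      \<le> emeasure (leb_power (verts G)) (pack G {0..max 0 a})"
    using assms by (intro emeasure_mono pack_mono sets_pack) auto
  also have "\<dots> \<le> ennreal (max 0 a ^ card (verts G))"
    using assms by (intro emeasure_pack_le) auto
  also have "\<dots> < \<infinity>" by simp
  finally show ?thesis .
qed

lemma finite_edges:
  assumes "simple_graph G"
  shows "finite (edges G)"
  using assms finite_subset[of "edges G" "Pow (verts G)"] by (auto simp: simple_graph_def)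

lemma prod_edge_K:
  assumes "simple_graph G" "x \<in> verts G \<rightarrow>\<^sub>E A"
  shows "(\<Prod>e\<in>edges G. edge_K x e) = indicator (pack G A) x"
proof -
  \<comment> \<open>\<open>edge_K\<close> is a definite description, so an edge has to be exhibited
    as a pair before its factor can be evaluated as 0 or 1.\<close>
  have edge: "\<exists>i\<in>verts G. \<exists>j\<in>verts G. e = {i, j}" if "e \<in> edges G" for e
    using assms(1) that unfolding simple_graph_def by (metis card_2_iff insert_subset)
  show ?thesis
  proof (cases "x \<in> pack G A")
    case True
    have "edge_K x e = 1" if e: "e \<in> edges G" for e
    proof -
      from edge[OF e] obtain i j where ij: "i \<in> verts G" "j \<in> verts G" "e = {i, j}" by blast
      with True e have "x i + x j \<le> 1" by (auto simp: pack_def)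
      then show ?thesis by (simp add: ij edge_K_pair K_def)
    qed
    with True show ?thesis by simp
  next
    case False
    with assms(2) obtain i j where "{i, j} \<in> edges G" "\<not> x i + x j \<le> 1"
      by (auto simp: pack_def)
    then have "\<exists>e\<in>edges G. edge_K x e = 0"
      by (intro bexI[of _ "{i, j}"]) (auto simp: edge_K_pair K_def)
    with False show ?thesis
      using finite_edges[OF assms(1)] by (simp add: prod_zero)
  qed
qed

lemma vol_eq_measure:
  assumes "simple_graph G"
  shows "vol G a = measure (leb_power (verts G)) (pack G {0..a})"
proof -
  have fin: "finite (verts G)" using assms by (simp add: simple_graph_def)
  have "vol G a = (LINT x|leb_power (verts G). indicator (pack G {0..a}) x)"
    unfolding vol_def set_lebesgue_integral_def
    using prod_edge_K[OF assms, of _ "{0..a}"]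
    by (intro Bochner_Integration.integral_cong) (auto simp: indicator_def pack_def)
  also have "\<dots> = measure (leb_power (verts G)) (pack G {0..a})"
    using fin by (simp add: pack_def space_leb_power Int_absorb2 PiE_iff subset_eq)
  finally show ?thesis .
qed

text \<open>The working form of the volume: identities are proved for \<open>emeasure\<close> and
  carried back to the reals by nonnegativity.\<close>

lemma ennreal_vol:
  assumes "simple_graph G"
  shows "ennreal (vol G a) = emeasure (leb_power (verts G)) (pack G {0..a})"
  using emeasure_pack_finite[of G a] assms
  by (simp add: vol_eq_measure emeasure_eq_ennreal_measure simple_graph_def)

lemma vol_nonneg: "simple_graph G \<Longrightarrow> vol G a \<ge> 0"
  by (simp add: vol_eq_measure)

lemma vol_mono:
  assumes "simple_graph G" "a \<le> b"
  shows "vol G a \<le> vol G b"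
proof -
  have "ennreal (vol G a) \<le> ennreal (vol G b)"
    unfolding ennreal_vol[OF assms(1)]
    using assms by (intro emeasure_mono pack_mono sets_pack) (auto simp: simple_graph_def)
  then show ?thesis using vol_nonneg[OF assms(1)] by simp
qed

section \<open>Piecewise polynomiality of the sliced volume\<close>

lemma vol_le_half:
  assumes "simple_graph G" "0 \<le> a" "a \<le> 1/2"
  shows "vol G a = a ^ card (verts G)"
proof -
  have "pack G {0..a} = verts G \<rightarrow>\<^sub>E {0..a}"
  proof -
    have "x i + x j \<le> 1" if "x \<in> verts G \<rightarrow>\<^sub>E {0..a}" "i \<in> verts G" "j \<in> verts G" for x i j
      using PiE_mem[OF that(1,2)] PiE_mem[OF that(1,3)] assms(3) by simp
    then show ?thesis by (auto simp: pack_def)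
  qed
  moreover have "finite (verts G)" using assms by (simp add: simple_graph_def)
  ultimately have "ennreal (vol G a) = ennreal (a ^ card (verts G))"
    using assms by (simp add: ennreal_vol lborel_power.emeasure_PiM ennreal_power)
  then show ?thesis using assms vol_nonneg[OF assms(1), of a] by simp
qed

text \<open>Holds the constraints that remain once the coordinates outside \<open>S\<close> are too
  small to violate any. \<open>S\<close> may be empty, and then this is not a
  \<open>simple_graph\<close>; hence the lemmas on \<open>pack\<close> applied to it ask only for a
  finite vertex set.\<close>

definition induced :: "'a graph \<Rightarrow> 'a set \<Rightarrow> 'a graph" where
  "induced G S = \<lparr>verts = S, edges = {e \<in> edges G. e \<subseteq> S}\<rparr>"

lemma verts_induced [simp]: "verts (induced G S) = S"
  by (simp add: induced_def)

text \<open>The product measure over \<open>I \<union> J\<close> is the image of the binary product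
  under \<open>merge\<close>, and the hypothesis \<open>eq\<close> says that the preimage of
  \<open>C\<close> is a rectangle.\<close>

lemma emeasure_merge_Times:
  assumes "finite I" "finite J" "I \<inter> J = {}"
    and "A \<in> sets (leb_power I)" "B \<in> sets (leb_power J)" "C \<in> sets (leb_power (I \<union> J))"
    and eq: "\<And>x y. x \<in> space (leb_power I) \<Longrightarrow> y \<in> space (leb_power J) \<Longrightarrow>
       merge I J (x, y) \<in> C \<longleftrightarrow> x \<in> A \<and> y \<in> B"
  shows "emeasure (leb_power (I \<union> J)) C = emeasure (leb_power I) A * emeasure (leb_power J) B"
proof -
  interpret J: sigma_finite_measure "leb_power J"
    using assms by (intro sigma_finite_leb_power)
  have "merge I J -` C \<inter> space (leb_power I \<Otimes>\<^sub>M leb_power J) = A \<times> B"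
    using eq assms(4,5)[THEN sets.sets_into_space] by (fastforce simp: space_pair_measure simp del: space_lborel)
  then show ?thesis
    using assms
    by (subst lborel_power.distr_merge[symmetric])
      (simp_all add: emeasure_distr J.emeasure_pair_measure_Times)
qed

lemma emeasure_lborel_affine_vimage:
  fixes l t :: real
  assumes "l > 0" "A \<in> sets borel"
  shows "emeasure lborel A = ennreal l * emeasure lborel ((\<lambda>x. t + l * x) -` A)"
  using assms
  by (subst lborel_real_affine[of l t])
    (simp_all add: emeasure_density nn_integral_cmult emeasure_distr space_borel)

text \<open>A finite product measure is determined by its values on boxes, where each coordinate
  contributes a factor \<open>l\<close>; \<open>l ^ card I\<close> is the Jacobian.\<close>

lemma leb_power_affine:
  fixes l t :: real
  assumes "finite I" "l > 0"
  shows "leb_power I = scale_measure (ennreal (l ^ card I))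
    (distr (leb_power I) (leb_power I) (\<lambda>x. \<lambda>i\<in>I. t + l * x i))" (is "_ = scale_measure _ (distr _ _ ?T)")
proof (rule sym, rule lborel_power.PiM_eqI)
  have T[measurable]: "?T \<in> leb_power I \<rightarrow>\<^sub>M leb_power I"
    by (intro measurable_restrict) measurable
  fix A :: "'a \<Rightarrow> real set" assume A: "\<And>i. i \<in> I \<Longrightarrow> A i \<in> sets lborel"
  have "?T -` (Pi\<^sub>E I A) \<inter> space (leb_power I) = (\<Pi>\<^sub>E i\<in>I. (\<lambda>x. t + l * x) -` A i)"
    by (auto simp: space_leb_power PiE_iff extensional_def)
  moreover have "(\<lambda>x. t + l * x) -` A i \<in> sets borel" if "i \<in> I" for i
    using A[OF that] measurable_sets[of "\<lambda>x. t + l * x" borel borel "A i"] by simp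
  ultimately show "emeasure (scale_measure (ennreal (l ^ card I)) (distr (leb_power I) (leb_power I) ?T)) (Pi\<^sub>E I A)
      = (\<Prod>i\<in>I. emeasure lborel (A i))"
    using assms A
    by (simp add: emeasure_distr sets_PiM_I_finite lborel_power.emeasure_PiM
       emeasure_lborel_affine_vimage[of l _ t] prod.distrib ennreal_power)
qed (use assms in simp_all)

lemma emeasure_pack_scale:
  assumes "finite (verts G)" "a > 1/2"
  shows "emeasure (leb_power (verts G)) (pack G {1-a<..a}) =
    ennreal ((2 * a - 1) ^ card (verts G)) * emeasure (leb_power (verts G)) (pack G {0<..1})"
proof -
  \<comment> \<open>The increasing affine bijection from \<open>{0<..1}\<close> onto
    \<open>{1-a<..a}\<close>. It fixes 1/2, and h s + h t - 1 = (2a - 1)(s + t - 1), so it preserves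
    the edge constraints exactly.\<close>
  define h where "h s = (1 - a) + (2 * a - 1) * s" for s
  define T where "T = (\<lambda>x. \<lambda>i\<in>verts G. h (x i))"
  have T: "T \<in> leb_power (verts G) \<rightarrow>\<^sub>M leb_power (verts G)"
    unfolding T_def h_def by (intro measurable_restrict) measurable
  have pos: "0 < 2 * a - 1" using assms by simp
  have h: "1 - a < h s \<longleftrightarrow> 0 < s" "h s \<le> a \<longleftrightarrow> s \<le> 1" "h s + h t \<le> 1 \<longleftrightarrow> s + t \<le> 1" for s t
  proof -
    show "1 - a < h s \<longleftrightarrow> 0 < s" using pos by (simp add: h_def zero_less_mult_iff)
    show "h s \<le> a \<longleftrightarrow> s \<le> 1"
      using mult_le_cancel_left_pos[OF pos, of s 1] by (auto simp: h_def)
    show "h s + h t \<le> 1 \<longleftrightarrow> s + t \<le> 1"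
      using mult_le_cancel_left_pos[OF pos, of "s + t" 1] by (auto simp: h_def algebra_simps)
  qed
  have "T x \<in> pack G {1-a<..a} \<longleftrightarrow> x \<in> pack G {0<..1}" if "x \<in> extensional (verts G)" for x
    using that by (simp add: pack_def T_def PiE_iff h)
  then have "T -` pack G {1-a<..a} \<inter> space (leb_power (verts G)) = pack G {0<..1}"
    by (auto simp: space_leb_power PiE_iff) (auto simp: pack_def PiE_iff extensional_def)
  then show ?thesis
    using assms T
    by (subst leb_power_affine[of "verts G" "2 * a - 1" "1 - a"])
      (auto simp: emeasure_distr sets_pack T_def[symmetric] h_def[symmetric])
qed

text \<open>For \<open>a \<ge> 1/2\<close>, coordinates in \<open>[0, 1 - a]\<close> are unconstrained. Splitting according to the
  set \<open>S\<close> of coordinates above \<open>1 - a\<close>, and rescaling those about the fixed point \<open>1/2\<close> of the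
  reflection \<open>s \<mapsto> 1 - s\<close>, leaves a volume that does not depend on \<open>a\<close>.\<close>

lemma vol_ge_half:
  assumes "simple_graph G" "1/2 < a" "a \<le> 1"
  shows "vol G a = (\<Sum>S\<in>Pow (verts G). (1 - a) ^ card (verts G - S) * (2 * a - 1) ^ card S *
     measure (leb_power S) (pack (induced G S) {0<..1}))"
proof -
  let ?V = "verts G"
  have fin: "finite ?V" using assms by (simp add: simple_graph_def)
  \<comment> \<open>The strict inequality puts each configuration into exactly one
    \<open>T S\<close>; this is why the ranges are open on the left.\<close>
  define T where "T S = {x \<in> pack G {0..a}. {i \<in> ?V. x i > 1 - a} = S}" for S
  have T: "T S \<in> sets (leb_power ?V)" if "S \<subseteq> ?V" for S
  proof -
    have [measurable]: "pack G {0..a} \<in> sets (leb_power ?V)" using fin by simp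
    have "T S = {x \<in> space (leb_power ?V). x \<in> pack G {0..a} \<and> (\<forall>i\<in>?V. x i > 1 - a \<longleftrightarrow> i \<in> S)}"
      using that by (auto simp: T_def pack_def space_leb_power PiE_iff)
    also have "\<dots> \<in> sets (leb_power ?V)" using fin by measurable
    finally show ?thesis .
  qed
  have ET: "emeasure (leb_power ?V) (T S) = ennreal ((1 - a) ^ card (?V - S) * (2 * a - 1) ^ card S *
     measure (leb_power S) (pack (induced G S) {0<..1}))" if S: "S \<subseteq> ?V" for S
  proof -
    have finS: "finite S" using S fin finite_subset by blast
    have un: "S \<union> (?V - S) = ?V" using S by auto
    have "emeasure (leb_power (S \<union> (?V - S))) (T S)
      = emeasure (leb_power S) (pack (induced G S) {1-a<..a}) * emeasure (leb_power (?V - S)) ((?V - S) \<rightarrow>\<^sub>E {0..1-a})"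
    proof (rule emeasure_merge_Times)
      show "T S \<in> sets (leb_power (S \<union> (?V - S)))" using T[OF S] un by simp
      show "pack (induced G S) {1-a<..a} \<in> sets (leb_power S)"
        using sets_pack[of "induced G S" "{1-a<..a}"] finS by simp
      show "merge S (?V - S) (x, y) \<in> T S \<longleftrightarrow>
          x \<in> pack (induced G S) {1-a<..a} \<and> y \<in> (?V - S) \<rightarrow>\<^sub>E {0..1-a}"
        if x: "x \<in> space (leb_power S)" and y: "y \<in> space (leb_power (?V - S))" for x y
      proof -
        let ?z = "merge S (?V - S) (x, y)"
        have z: "?z i = x i" if "i \<in> S" for i using that by (simp add: merge_def)
        have z': "?z i = y i" if "i \<in> ?V - S" for i using that by (simp add: merge_def)
        have zx: "?z \<in> extensional ?V" using S by (auto simp: merge_def extensional_def)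
        have xe: "x \<in> extensional S" "y \<in> extensional (?V - S)"
          using x y by (auto simp: space_leb_power PiE_iff)
        show ?thesis
        proof
          assume l: "?z \<in> T S"
          then have 1: "\<And>i. i \<in> ?V \<Longrightarrow> 0 \<le> ?z i \<and> ?z i \<le> a" "\<And>i. i \<in> ?V \<Longrightarrow> ?z i > 1 - a \<longleftrightarrow> i \<in> S"
            and 2: "\<And>i j. i \<in> ?V \<Longrightarrow> j \<in> ?V \<Longrightarrow> {i, j} \<in> edges G \<Longrightarrow> ?z i + ?z j \<le> 1"
            by (auto simp: T_def pack_def PiE_iff)
          have "x \<in> pack (induced G S) {1-a<..a}"
          proof -
            have "1 - a < x i \<and> x i \<le> a" if "i \<in> S" for i
              using 1[of i] z[OF that] that S by auto
            moreover have "x i + x j \<le> 1" if "i \<in> S" "j \<in> S" "{i, j} \<in> edges G" for i j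
              using 2[of i j] z that S by auto
            ultimately show ?thesis
              using xe by (auto simp: pack_def PiE_iff induced_def)
          qed
          moreover have "y \<in> (?V - S) \<rightarrow>\<^sub>E {0..1-a}"
          proof -
            have "0 \<le> y i \<and> y i \<le> 1 - a" if "i \<in> ?V - S" for i
              using 1[of i] z'[OF that] that by auto
            with xe show ?thesis by (auto simp: PiE_iff)
          qed
          ultimately show "x \<in> pack (induced G S) {1-a<..a} \<and> y \<in> (?V - S) \<rightarrow>\<^sub>E {0..1-a}" ..
        next
          assume r: "x \<in> pack (induced G S) {1-a<..a} \<and> y \<in> (?V - S) \<rightarrow>\<^sub>E {0..1-a}"
          have zS: "1 - a < ?z i \<and> ?z i \<le> a" if "i \<in> S" for i
            using r that z[OF that] by (auto simp: pack_def PiE_iff)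
          have zN: "0 \<le> ?z i \<and> ?z i \<le> 1 - a" if "i \<in> ?V - S" for i
            using r that z'[OF that] by (auto simp: PiE_iff)
          have za: "0 \<le> ?z i \<and> ?z i \<le> a" if "i \<in> ?V" for i
            using zS[of i] zN[of i] that assms by fastforce
          have "?z i + ?z j \<le> 1" if "i \<in> ?V" "j \<in> ?V" "{i, j} \<in> edges G" for i j
          proof (cases "i \<in> S \<and> j \<in> S")
            case True
            then have "x i + x j \<le> 1"
              using r that by (auto simp: pack_def induced_def)
            with True show ?thesis by (simp add: z)
          next
            \<comment> \<open>One endpoint has coordinate at most 1 - a and the other at most a, so
              this edge holds automatically.\<close>
            case False
            then show ?thesis
              using zN[of i] zN[of j] za[of i] za[of j] that by fastforce
          qed
          moreover have "{i \<in> ?V. ?z i > 1 - a} = S"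
            using zS zN S by fastforce
          ultimately show "?z \<in> T S"
            using za zx by (auto simp: T_def pack_def PiE_iff)
        qed
      qed
    qed (use fin finS in \<open>auto intro!: sets_PiM_I_finite\<close>)
    also have "emeasure (leb_power (?V - S)) ((?V - S) \<rightarrow>\<^sub>E {0..1-a}) = ennreal ((1 - a) ^ card (?V - S))"
      using fin assms by (simp add: lborel_power.emeasure_PiM ennreal_power)
    also have "emeasure (leb_power S) (pack (induced G S) {1-a<..a}) =
        ennreal ((2 * a - 1) ^ card S) * emeasure (leb_power S) (pack (induced G S) {0<..1})"
      using emeasure_pack_scale[of "induced G S" a] finS assms by simp
    also have "emeasure (leb_power S) (pack (induced G S) {0<..1}) =
       ennreal (measure (leb_power S) (pack (induced G S) {0<..1}))"
    proof -
      have "emeasure (leb_power S) (pack (induced G S) {0<..1}) \<le> emeasure (leb_power S) (pack (induced G S) {0..1})"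
        using sets_pack[of "induced G S" "{0..1}"] finS by (intro emeasure_mono pack_mono) auto
      also have "\<dots> < \<infinity>"
        using emeasure_pack_finite[of "induced G S" 1] finS by simp
      finally show ?thesis by (simp add: emeasure_eq_ennreal_measure)
    qed
    finally show ?thesis
      using assms un by (simp add: ennreal_mult[symmetric] mult_ac)
  qed
  have "pack G {0..a} = (\<Union>S\<in>Pow ?V. T S)"
  proof (intro equalityI subsetI)
    fix x assume "x \<in> pack G {0..a}"
    then have "x \<in> T {i \<in> ?V. x i > 1 - a}" by (simp add: T_def)
    then show "x \<in> (\<Union>S\<in>Pow ?V. T S)" by (rule UN_I[rotated]) simp
  qed (simp add: T_def)
  moreover have "disjoint_family_on T (Pow ?V)"
  proof -
    have "S = S'" if "x \<in> T S" "x \<in> T S'" for x S S'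
      using that unfolding T_def mem_Collect_eq by metis
    then show ?thesis unfolding disjoint_family_on_def by blast
  qed
  ultimately have "emeasure (leb_power ?V) (pack G {0..a}) = (\<Sum>S\<in>Pow ?V. emeasure (leb_power ?V) (T S))"
    using fin T by (simp add: sum_emeasure image_subset_iff)
  also have "\<dots> = (\<Sum>S\<in>Pow ?V. ennreal ((1 - a) ^ card (?V - S) * (2 * a - 1) ^ card S *
     measure (leb_power S) (pack (induced G S) {0<..1})))"
    using ET by (intro sum.cong) auto
  also have "\<dots> = ennreal (\<Sum>S\<in>Pow ?V. (1 - a) ^ card (?V - S) * (2 * a - 1) ^ card S *
     measure (leb_power S) (pack (induced G S) {0<..1}))"
    using assms by (intro sum_ennreal) auto
  finally have "ennreal (vol G a) = \<dots>"
    by (simp add: ennreal_vol[OF assms(1)])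
  then show ?thesis
    using assms vol_nonneg[OF assms(1), of a] by (simp add: sum_nonneg)
qed

text \<open>The left endpoint is included so that both pieces cover 1/2, which gives continuity
  there. The rescaling degenerates at that point, so it is treated separately.\<close>

lemma vol_poly:
  assumes "simple_graph G"
  obtains p :: "real poly" where "\<And>a. 1/2 \<le> a \<Longrightarrow> a \<le> 1 \<Longrightarrow> vol G a = poly p a"
proof
  let ?V = "verts G"
  define v where "v S = measure (leb_power S) (pack (induced G S) {0<..1})" for S
  \<comment> \<open>The linear polynomials stand for 1 - a and 2a - 1.\<close>
  define p where "p = (\<Sum>S\<in>Pow ?V. [:1, -1:] ^ card (?V - S) * [:-1, 2:] ^ card S * [:v S:])"
  have p: "poly p a = (\<Sum>S\<in>Pow ?V. (1 - a) ^ card (?V - S) * (2 * a - 1) ^ card S * v S)" for a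
    by (simp add: p_def poly_sum poly_mult poly_power algebra_simps)
  fix a :: real assume a: "1/2 \<le> a" "a \<le> 1"
  show "vol G a = poly p a"
  proof (cases "a = 1/2")
    case False
    with a vol_ge_half[OF assms] show ?thesis by (simp add: p v_def)
  next
    \<comment> \<open>With 2a - 1 = 0 only \<open>S = {}\<close> survives, because 0 ^ 0 = 1. Its
      coefficient is the mass 1 of the one-point product over no coordinates.\<close>
    case True
    have fin: "finite ?V" using assms by (simp add: simple_graph_def)
    have "poly p a = (\<Sum>S\<in>Pow ?V. if S = {} then (1 / 2) ^ card ?V * v {} else 0)"
      unfolding p True using fin
      by (intro sum.cong) (auto simp: card_gt_0_iff finite_subset power_0_left)
    also have "\<dots> = (1 / 2) ^ card ?V * v {}"
      using fin by simp
    also have "v {} = 1"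
    proof -
      have "pack (induced G {}) {0<..1} = {\<lambda>_. undefined}"
        by (auto simp: pack_def)
      then show ?thesis by (simp add: v_def measure_def)
    qed
    finally have "poly p a = (1 / 2) ^ card ?V" by simp
    then show ?thesis using vol_le_half[OF assms, of a] unfolding True by simp
  qed
qed

section \<open>The density of the largest coordinate\<close>

lemma Max_image_le_iff:
  fixes x :: "'a \<Rightarrow> real"
  assumes "finite I" "I \<noteq> {}"
  shows "Max (x ` I) \<le> c \<longleftrightarrow> (\<forall>i\<in>I. x i \<le> c)"
  using assms by simp

lemma pack_Max_le:
  assumes "simple_graph G" "c \<le> 1"
  shows "{x \<in> pack G {0..1}. Max (x ` verts G) \<le> c} = pack G {0..c}"
proof -
  have "s \<in> {0..c} \<longleftrightarrow> s \<in> {0..1} \<and> s \<le> c" for s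
    using assms(2) by auto
  moreover have "finite (verts G)" "verts G \<noteq> {}"
    using assms(1) by (simp_all add: simple_graph_def)
  ultimately show ?thesis
    by (simp only: set_eq_iff mem_Collect_eq pack_def PiE_iff ball_conj_distrib conj_ac
        Max_image_le_iff simp_thms)
qed

text \<open>The law is not normalised: its total mass is \<open>vol G 1\<close>. It is built as an
  image of a density so that integrals against it unfold to integrals over configurations.\<close>

definition max_law :: "'a graph \<Rightarrow> real measure" where
  "max_law G = distr (density (leb_power (verts G)) (indicator (pack G {0..1}))) borel
     (\<lambda>x. Max (x ` verts G))"

lemma measurable_Max_image [measurable]:
  "finite I \<Longrightarrow> (\<lambda>x. Max (x ` I)) \<in> borel_measurable (leb_power I)"
  by measurable

lemma nn_integral_max_law:
  assumes "simple_graph G" "f \<in> borel_measurable borel"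
  shows "(\<integral>\<^sup>+s. f s \<partial>max_law G) =
    (\<integral>\<^sup>+x. indicator (pack G {0..1}) x * f (Max (x ` verts G)) \<partial>leb_power (verts G))"
proof -
  have fin: "finite (verts G)" using assms by (simp add: simple_graph_def)
  have [measurable]: "pack G {0..1} \<in> sets (leb_power (verts G))" "f \<in> borel_measurable borel"
    "(\<lambda>x. Max (x ` verts G)) \<in> borel_measurable (leb_power (verts G))"
    using fin assms(2) by auto
  show ?thesis
    unfolding max_law_def by (subst nn_integral_distr) (simp_all add: nn_integral_density)
qed

lemma emeasure_max_law_atMost:
  assumes "simple_graph G" "0 \<le> c"
  shows "emeasure (max_law G) {..c} = ennreal (vol G (min c 1))"
proof -
  have fin: "finite (verts G)" using assms by (simp add: simple_graph_def)
  have "emeasure (max_law G) {..c} = (\<integral>\<^sup>+s. indicator {..c} s \<partial>max_law G)"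
    by (simp add: max_law_def)
  also have "\<dots> = (\<integral>\<^sup>+x. indicator (pack G {0..1}) x * indicator {..c} (Max (x ` verts G)) \<partial>leb_power (verts G))"
    by (rule nn_integral_max_law[OF assms(1)]) simp
  also have "\<dots> = (\<integral>\<^sup>+x. indicator (pack G {0..min c 1}) x \<partial>leb_power (verts G))"
  proof (intro nn_integral_cong)
    fix x
    have "x \<in> pack G {0..1} \<Longrightarrow> Max (x ` verts G) \<le> 1"
      using assms by (auto simp: pack_def PiE_iff simple_graph_def)
    then have "x \<in> pack G {0..min c 1} \<longleftrightarrow> x \<in> pack G {0..1} \<and> Max (x ` verts G) \<le> c"
      using pack_Max_le[OF assms(1), of "min c 1"] by auto
    then show "indicator (pack G {0..1}) x * indicator {..c} (Max (x ` verts G))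
        = (indicator (pack G {0..min c 1}) x :: ennreal)"
      by (simp add: indicator_def)
  qed
  also have "\<dots> = ennreal (vol G (min c 1))"
    using fin by (simp add: ennreal_vol[OF assms(1)])
  finally show ?thesis .
qed

lemma emeasure_max_law_UNIV:
  assumes "simple_graph G"
  shows "emeasure (max_law G) UNIV = ennreal (vol G 1)"
proof -
  have "emeasure (max_law G) UNIV = (\<integral>\<^sup>+s. 1 \<partial>max_law G)"
    by (simp add: max_law_def)
  also have "\<dots> = emeasure (leb_power (verts G)) (pack G {0..1})"
    using assms by (subst nn_integral_max_law) (auto simp: simple_graph_def)
  finally show ?thesis by (simp add: ennreal_vol[OF assms])
qed

text \<open>A nonempty vertex set makes the exponent positive. This removes the boundary term when
  the derivative is integrated from 0.\<close>

lemma vol_zero: "simple_graph G \<Longrightarrow> vol G 0 = 0"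
  by (subst vol_le_half) (auto simp: simple_graph_def card_gt_0_iff)

lemma emeasure_max_law_atMost_neg:
  assumes "simple_graph G" "c < 0"
  shows "emeasure (max_law G) {..c} = 0"
proof -
  have "emeasure (max_law G) {..c} \<le> emeasure (max_law G) {..0}"
    using assms by (intro emeasure_mono) (auto simp: max_law_def)
  then show ?thesis using emeasure_max_law_atMost[OF assms(1), of 0] vol_zero[OF assms(1)] by simp
qed

text \<open>The complementary half-lines \<open>{c<..}\<close> determine a Borel measure; finite and
  equal total masses allow passing to complements by subtraction.\<close>

lemma measure_eqI_atMost:
  fixes M N :: "real measure"
  assumes sets: "sets M = sets borel" "sets N = sets borel"
    and fin: "emeasure M UNIV < \<infinity>"
    and tot: "emeasure M UNIV = emeasure N UNIV"
    and eq: "\<And>c. emeasure M {..c} = emeasure N {..c}"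
  shows "M = N"
proof (rule measure_eqI_lessThan)
  have sp: "space M = UNIV" "space N = UNIV"
    using sets_eq_imp_space_eq[OF sets(1)] sets_eq_imp_space_eq[OF sets(2)] by auto
  have *: "emeasure L {c<..} = emeasure L UNIV - emeasure L {..c}"
    if "sets L = sets borel" "emeasure L UNIV < \<infinity>" for L :: "real measure" and c
  proof -
    have "emeasure L {..c} \<le> emeasure L UNIV" using that by (intro emeasure_mono) auto
    then have "emeasure L (UNIV - {..c}) = emeasure L UNIV - emeasure L {..c}"
      using that by (intro emeasure_Diff) (auto simp: top_unique)
    moreover have "UNIV - {..c} = {c<..}" by auto
    ultimately show ?thesis by simp
  qed
  show "emeasure M {c<..} = emeasure N {c<..}" for c
    using *[of M c] *[of N c] sets fin tot eq by simp
  show "emeasure M {c<..} < \<infinity>" for c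
    using fin emeasure_mono[of "{c<..}" UNIV M] sets by (auto simp: le_less_trans)
qed fact+

lemma continuous_on_vol:
  assumes "simple_graph G"
  shows "continuous_on {0..1} (vol G)"
proof -
  obtain p where p: "\<And>a. 1/2 \<le> a \<Longrightarrow> a \<le> 1 \<Longrightarrow> vol G a = poly p a"
    using vol_poly[OF assms] by blast
  have "continuous_on {0..1/2} (vol G)"
    using vol_le_half[OF assms] by (subst continuous_on_cong[OF refl, of _ _ "\<lambda>a. a ^ card (verts G)"]) (auto intro!: continuous_intros)
  moreover have "continuous_on {1/2..1} (vol G)"
    using p by (subst continuous_on_cong[OF refl, of _ _ "poly p"]) (auto intro!: continuous_intros)
  ultimately have "continuous_on ({0..1/2} \<union> {1/2..1}) (vol G)"
    by (intro continuous_on_closed_Un) auto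
  moreover have "{0..1/2} \<union> {1/2..1} = {0..1::real}" by auto
  ultimately show ?thesis by simp
qed

text \<open>Differentiability at \<open>1/2\<close> is left open: a finite exceptional set is harmless for the
  integrals below.\<close>

lemma vol_deriv_density:
  assumes "simple_graph G"
  obtains g :: "real \<Rightarrow> real" where
    "g \<in> borel_measurable borel" "\<And>s. g s \<ge> 0"
    "\<And>s. s \<in> {0<..<1} - {1/2} \<Longrightarrow> vol_deriv G s = g s"
    "max_law G = density lborel (\<lambda>s. indicator {0..1} s * ennreal (g s))"
proof -
  obtain p where p: "\<And>a. 1/2 \<le> a \<Longrightarrow> a \<le> 1 \<Longrightarrow> vol G a = poly p a"
    using vol_poly[OF assms] by blast
  let ?n = "card (verts G)"
  \<comment> \<open>Truncation at 0 makes the density nonnegative everywhere, also outside the unit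
    interval, where nothing is known about the sign of the two formulas.\<close>
  define g where "g s = max 0 (if s \<le> 1/2 then real ?n * s ^ (?n - 1) else poly (pderiv p) s)" for s
  have meas [measurable]: "g \<in> borel_measurable borel"
  proof -
    have [measurable]: "poly (pderiv p) \<in> borel_measurable borel"
      by (intro borel_measurable_continuous_onI continuous_intros)
    show ?thesis unfolding g_def by measurable
  qed
  have nonneg: "g s \<ge> 0" for s by (simp add: g_def)
  have deriv: "(vol G has_real_derivative g s) (at s)" if s: "s \<in> {0<..<1} - {1/2}" for s
  proof -
    have "\<exists>D. (vol G has_real_derivative D) (at s) \<and> g s = max 0 D"
    proof (cases "s < 1/2")
      case True
      have "((\<lambda>a. a ^ ?n) has_real_derivative real ?n * s ^ (?n - 1)) (at s)"
        by (auto intro!: derivative_eq_intros)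
      then have "(vol G has_real_derivative real ?n * s ^ (?n - 1)) (at s)"
        by (rule has_field_derivative_transform_within_open[where S="{0<..<1/2}"])
          (use s True vol_le_half[OF assms] in auto)
      with True show ?thesis by (auto simp: g_def)
    next
      case False
      have "(poly p has_real_derivative poly (pderiv p) s) (at s)"
        by (rule poly_DERIV)
      then have "(vol G has_real_derivative poly (pderiv p) s) (at s)"
        by (rule has_field_derivative_transform_within_open[where S="{1/2<..<1}"])
          (use s False p in auto)
      with False s show ?thesis by (auto simp: g_def)
    qed
    then obtain D where D: "(vol G has_real_derivative D) (at s)" "g s = max 0 D" by blast
    \<comment> \<open>\<open>vol G\<close> is monotone on the whole line, so at the points
      considered the truncation changes nothing.\<close>
    have "D \<ge> 0"
      using vol_mono[OF assms] by (intro mono_on_imp_deriv_nonneg[OF _ D(1), of UNIV]) (auto simp: mono_on_def)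
    with D show ?thesis by simp
  qed
  have vd: "vol_deriv G s = g s" if s: "s \<in> {0<..<1} - {1/2}" for s
  proof -
    have "at s within {0..1} = at s" using s by (intro at_within_interior) auto
    then show ?thesis
      unfolding vol_deriv_def using deriv[OF s]
      by (simp add: has_real_derivative_iff_has_vector_derivative vector_derivative_at)
  qed
  have int: "(\<integral>\<^sup>+s. indicator {0..c} s * ennreal (g s) \<partial>lborel) = ennreal (vol G c)" if c: "0 \<le> c" "c \<le> 1" for c
  proof -
    \<comment> \<open>The fundamental theorem needs continuity on the closed interval and a
      derivative inside it off the finite set \<open>{1/2}\<close>.\<close>
    have "(g has_integral (vol G c - vol G 0)) {0..c}"
      using c deriv continuous_on_subset[OF continuous_on_vol[OF assms], of "{0..c}"]
      by (intro fundamental_theorem_of_calculus_interior_strong[of "{1/2}"])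
        (auto simp: has_real_derivative_iff_has_vector_derivative)
    then have "(\<integral>\<^sup>+s. ennreal (indicator {0..c} s * g s) \<partial>lborel) = ennreal (vol G c)"
      using nonneg by (intro nn_integral_has_integral_lebesgue) (simp_all add: vol_zero[OF assms])
    then show ?thesis by (simp add: ennreal_mult'' nonneg ennreal_indicator)
  qed
  let ?N = "density lborel (\<lambda>s. indicator {0..1} s * ennreal (g s))"
  have N: "emeasure ?N {..c} = ennreal (vol G (min c 1))" if "0 \<le> c" for c
  proof -
    have "emeasure ?N {..c} = (\<integral>\<^sup>+s. indicator {0..1} s * ennreal (g s) * indicator {..c} s \<partial>lborel)"
      by (subst emeasure_density) auto
    also have "\<dots> = (\<integral>\<^sup>+s. indicator {0..min c 1} s * ennreal (g s) \<partial>lborel)"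
      by (intro nn_integral_cong) (auto simp: indicator_def)
    finally show ?thesis using int[of "min c 1"] that by simp
  qed
  have tot: "emeasure (max_law G) UNIV = ennreal (vol G 1)"
    by (rule emeasure_max_law_UNIV[OF assms])
  have law: "max_law G = ?N"
  proof (rule measure_eqI_atMost)
    show "emeasure (max_law G) UNIV = emeasure ?N UNIV"
      using int[of 1] tot by (simp add: emeasure_density)
    show "emeasure (max_law G) {..c} = emeasure ?N {..c}" for c
    proof (cases "0 \<le> c")
      case True
      then show ?thesis using N emeasure_max_law_atMost[OF assms] by simp
    next
      case False
      have "emeasure ?N {..c} \<le> emeasure ?N {..0}"
        using False by (intro emeasure_mono) auto
      with False show ?thesis
        using N[of 0] emeasure_max_law_atMost_neg[OF assms] vol_zero[OF assms] by simp
    qed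
  qed (use tot in \<open>simp_all add: max_law_def\<close>)
  show thesis by (rule that[OF meas nonneg vd law])
qed

section \<open>The join\<close>

lemma simple_graph_join:
  assumes "simple_graph G" "simple_graph H" "verts G \<inter> verts H = {}"
  shows "simple_graph (graph_join G H)"
proof -
  have "e \<subseteq> verts G \<union> verts H \<and> card e = 2" if e: "e \<in> edges (graph_join G H)" for e
  proof -
    consider "e \<in> edges G" | "e \<in> edges H" | x y where "x \<in> verts G" "y \<in> verts H" "e = {x, y}"
      using e by (auto simp: graph_join_def)
    then show ?thesis
    proof cases
      case 3
      then have "x \<noteq> y" using assms(3) by auto
      with 3 show ?thesis by simp
    qed (use assms in \<open>auto simp: simple_graph_def\<close>)
  qed
  with assms show ?thesis by (simp add: simple_graph_def graph_join_def)
qed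

text \<open>Apart from the last condition, everything concerns one side only, so the two sides
  interact through their maxima alone. The \<open>H\<close> coordinates come first in
  \<open>merge\<close> because the integral over them is to be the outer one.\<close>

lemma merge_in_pack_join:
  assumes G: "simple_graph G" and H: "simple_graph H" and dis: "verts G \<inter> verts H = {}"
    and c: "c \<le> 1"
    and y: "y \<in> space (leb_power (verts H))" and x: "x \<in> space (leb_power (verts G))"
  shows "merge (verts H) (verts G) (y, x) \<in> pack (graph_join G H) {0..c} \<longleftrightarrow>
    y \<in> pack H {0..1} \<and> x \<in> pack G {0..1} \<and> Max (y ` verts H) \<le> c \<and> Max (x ` verts G) \<le> c \<and>
    Max (x ` verts G) + Max (y ` verts H) \<le> 1"
proof -
  let ?V = "verts G" and ?W = "verts H"
  let ?z = "merge ?W ?V (y, x)"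
  have fin: "finite ?V" "?V \<noteq> {}" "finite ?W" "?W \<noteq> {}"
    using G H by (auto simp: simple_graph_def)
  have zx: "?z i = x i" if "i \<in> ?V" for i using that dis by (auto simp: merge_def)
  have zy: "?z i = y i" if "i \<in> ?W" for i using that by (auto simp: merge_def)
  have ze: "?z \<in> extensional (?V \<union> ?W)" by (auto simp: merge_def extensional_def)
  have e: "x \<in> extensional ?V" "y \<in> extensional ?W"
    using x y by (auto simp: space_leb_power PiE_iff)
  have sub: "\<And>e. e \<in> edges G \<Longrightarrow> e \<subseteq> ?V" "\<And>e. e \<in> edges H \<Longrightarrow> e \<subseteq> ?W"
    using G H by (auto simp: simple_graph_def)
  have maxle: "Max (x ` ?V) + Max (y ` ?W) \<le> 1 \<longleftrightarrow> (\<forall>i\<in>?V. \<forall>j\<in>?W. x i + y j \<le> 1)"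
  proof
    assume m: "Max (x ` ?V) + Max (y ` ?W) \<le> 1"
    show "\<forall>i\<in>?V. \<forall>j\<in>?W. x i + y j \<le> 1"
    proof (intro ballI)
      fix i j assume "i \<in> ?V" "j \<in> ?W"
      then have "x i \<le> Max (x ` ?V)" "y j \<le> Max (y ` ?W)" using fin by auto
      with m show "x i + y j \<le> 1" by simp
    qed
  next
    assume a: "\<forall>i\<in>?V. \<forall>j\<in>?W. x i + y j \<le> 1"
    have "Max (x ` ?V) \<in> x ` ?V" "Max (y ` ?W) \<in> y ` ?W" using fin by (auto intro: Max_in)
    with a show "Max (x ` ?V) + Max (y ` ?W) \<le> 1" by auto
  qed
  have edge: "{i, j} \<in> edges (graph_join G H) \<longleftrightarrow>
     {i, j} \<in> edges G \<or> {i, j} \<in> edges H \<or> i \<in> ?V \<and> j \<in> ?W \<or> j \<in> ?V \<and> i \<in> ?W" for i j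
    by (auto simp: graph_join_def doubleton_eq_iff)
  have "?z \<in> pack (graph_join G H) {0..c} \<longleftrightarrow> (\<forall>i\<in>?V \<union> ?W. ?z i \<in> {0..c}) \<and>
      (\<forall>i\<in>?V \<union> ?W. \<forall>j\<in>?V \<union> ?W. {i, j} \<in> edges (graph_join G H) \<longrightarrow> ?z i + ?z j \<le> 1)"
    using ze by (simp add: pack_def PiE_iff graph_join_def)
  also have "\<dots> \<longleftrightarrow> (\<forall>i\<in>?V. x i \<in> {0..c}) \<and> (\<forall>i\<in>?W. y i \<in> {0..c}) \<and>
      (\<forall>i\<in>?V. \<forall>j\<in>?V. {i, j} \<in> edges G \<longrightarrow> x i + x j \<le> 1) \<and>
      (\<forall>i\<in>?W. \<forall>j\<in>?W. {i, j} \<in> edges H \<longrightarrow> y i + y j \<le> 1) \<and>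
      (\<forall>i\<in>?V. \<forall>j\<in>?W. x i + y j \<le> 1)" (is "?L \<longleftrightarrow> ?R")
  proof
    assume L: ?L
    then have L1: "\<And>i. i \<in> ?V \<union> ?W \<Longrightarrow> ?z i \<in> {0..c}" and
      L2: "\<And>i j. i \<in> ?V \<union> ?W \<Longrightarrow> j \<in> ?V \<union> ?W \<Longrightarrow> {i, j} \<in> edges (graph_join G H) \<Longrightarrow> ?z i + ?z j \<le> 1"
      by blast+
    show ?R
    proof (intro conjI ballI impI)
      show "x i \<in> {0..c}" if "i \<in> ?V" for i using L1[of i] zx that by simp
      show "y i \<in> {0..c}" if "i \<in> ?W" for i using L1[of i] zy that by simp
      show "x i + x j \<le> 1" if "i \<in> ?V" "j \<in> ?V" "{i, j} \<in> edges G" for i j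
        using L2[of i j] zx that edge by simp
      show "y i + y j \<le> 1" if "i \<in> ?W" "j \<in> ?W" "{i, j} \<in> edges H" for i j
        using L2[of i j] zy that edge by simp
      show "x i + y j \<le> 1" if "i \<in> ?V" "j \<in> ?W" for i j
        using L2[of i j] zx zy that edge by simp
    qed
  next
    assume R: ?R
    show ?L
    proof (intro conjI ballI impI)
      show "?z i \<in> {0..c}" if "i \<in> ?V \<union> ?W" for i
        using that R zx zy by auto
      show "?z i + ?z j \<le> 1" if "i \<in> ?V \<union> ?W" "j \<in> ?V \<union> ?W" and e: "{i, j} \<in> edges (graph_join G H)" for i j
      proof -
        consider "{i, j} \<in> edges G" | "{i, j} \<in> edges H" | "i \<in> ?V" "j \<in> ?W" | "j \<in> ?V" "i \<in> ?W"
          using iffD1[OF edge e] by blast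
        then show ?thesis
        proof cases
          case 1
          then have "i \<in> ?V" "j \<in> ?V" using sub(1) by auto
          with 1 R zx show ?thesis by simp
        next
          case 2
          then have "i \<in> ?W" "j \<in> ?W" using sub(2) by auto
          with 2 R zy show ?thesis by simp
        next
          case 3
          with R zx zy show ?thesis by simp
        next
          case 4
          with R zx zy show ?thesis by (simp add: add.commute)
        qed
      qed
    qed
  qed
  \<comment> \<open>The bound \<open>c\<close> is moved from the box to the maxima: configurations
    stay in the unit cube, so the laws do not depend on \<open>c\<close>, which only truncates the
    integrals.\<close>
  also have "\<dots> \<longleftrightarrow> (\<forall>i\<in>?V. x i \<in> {0..1} \<and> x i \<le> c) \<and> (\<forall>i\<in>?W. y i \<in> {0..1} \<and> y i \<le> c) \<and>
      (\<forall>i\<in>?V. \<forall>j\<in>?V. {i, j} \<in> edges G \<longrightarrow> x i + x j \<le> 1) \<and>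
      (\<forall>i\<in>?W. \<forall>j\<in>?W. {i, j} \<in> edges H \<longrightarrow> y i + y j \<le> 1) \<and>
      Max (x ` ?V) + Max (y ` ?W) \<le> 1"
  proof -
    have "s \<in> {0..c} \<longleftrightarrow> s \<in> {0..1} \<and> s \<le> c" for s using c by auto
    then show ?thesis by (simp only: maxle)
  qed
  also have "\<dots> \<longleftrightarrow> y \<in> pack H {0..1} \<and> x \<in> pack G {0..1} \<and> (\<forall>i\<in>?W. y i \<le> c) \<and> (\<forall>i\<in>?V. x i \<le> c) \<and>
    Max (x ` ?V) + Max (y ` ?W) \<le> 1"
    using e by (simp only: pack_def PiE_iff mem_Collect_eq ball_conj_distrib conj_ac simp_thms)
  finally show ?thesis by (simp only: Max_image_le_iff[OF fin(1,2)] Max_image_le_iff[OF fin(3,4)])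
qed

lemma borel_measurable_K [measurable (raw)]:
  assumes [measurable]: "f \<in> borel_measurable M" "h \<in> borel_measurable M"
  shows "(\<lambda>x. K (f x) (h x)) \<in> borel_measurable M"
  unfolding K_def by measurable

text \<open>The half-lines \<open>{..c}\<close> serve as well as \<open>{0..c}\<close>, since both
  laws are carried by the unit interval.\<close>

lemma vol_join:
  assumes G: "simple_graph G" and H: "simple_graph H" and dis: "verts G \<inter> verts H = {}"
    and c: "c \<le> 1"
  shows "ennreal (vol (graph_join G H) c) = (\<integral>\<^sup>+t. (\<integral>\<^sup>+s.
    indicator {..c} t * indicator {..c} s * ennreal (K s t) \<partial>max_law G) \<partial>max_law H)"
proof -
  let ?V = "verts G" and ?W = "verts H"
  have fin: "finite ?V" "finite ?W" using G H by (auto simp: simple_graph_def)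
  \<comment> \<open>The density serves only to show that the inner integral is measurable in the
    outer variable.\<close>
  obtain g where g[measurable]: "g \<in> borel_measurable borel"
      "max_law G = density lborel (\<lambda>s. indicator {0..1} s * ennreal (g s))"
    using vol_deriv_density[OF G] by metis
  let ?f = "\<lambda>t s. indicator {..c} t * indicator {..c} s * ennreal (K s t)"
  have pj: "pack (graph_join G H) {0..c} \<in> sets (leb_power (?W \<union> ?V))"
    using sets_pack[of "graph_join G H" "{0..c}"] fin by (simp add: graph_join_def Un_commute)
  have "ennreal (vol (graph_join G H) c) =
      (\<integral>\<^sup>+z. indicator (pack (graph_join G H) {0..c}) z \<partial>leb_power (?W \<union> ?V))"
    using pj ennreal_vol[OF simple_graph_join[OF G H dis], of c] by (simp add: graph_join_def Un_commute)
  also have "\<dots> = (\<integral>\<^sup>+y. (\<integral>\<^sup>+x. indicator (pack (graph_join G H) {0..c}) (merge ?W ?V (y, x))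
      \<partial>leb_power ?V) \<partial>leb_power ?W)"
    using fin dis pj by (intro lborel_power.product_nn_integral_fold) auto
  also have "\<dots> = (\<integral>\<^sup>+y. (\<integral>\<^sup>+x. indicator (pack H {0..1}) y * (indicator (pack G {0..1}) x *
      ?f (Max (y ` ?W)) (Max (x ` ?V))) \<partial>leb_power ?V) \<partial>leb_power ?W)"
    using merge_in_pack_join[OF G H dis c]
    by (intro nn_integral_cong) (simp add: indicator_def K_def)
  also have "\<dots> = (\<integral>\<^sup>+y. indicator (pack H {0..1}) y * (\<integral>\<^sup>+s. ?f (Max (y ` ?W)) s \<partial>max_law G) \<partial>leb_power ?W)"
  proof (intro nn_integral_cong)
    fix y
    have [measurable]: "pack G {0..1} \<in> sets (leb_power ?V)"
        "(\<lambda>x. Max (x ` ?V)) \<in> borel_measurable (leb_power ?V)"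
      using fin by auto
    show "(\<integral>\<^sup>+x. indicator (pack H {0..1}) y * (indicator (pack G {0..1}) x *
      ?f (Max (y ` ?W)) (Max (x ` ?V))) \<partial>leb_power ?V) =
       indicator (pack H {0..1}) y * (\<integral>\<^sup>+s. ?f (Max (y ` ?W)) s \<partial>max_law G)"
      by (subst nn_integral_max_law[OF G]) (simp_all add: nn_integral_cmult)
  qed
  also have "\<dots> = (\<integral>\<^sup>+t. (\<integral>\<^sup>+s. ?f t s \<partial>max_law G) \<partial>max_law H)"
  proof (rule nn_integral_max_law[OF H, symmetric])
    show "(\<lambda>t. \<integral>\<^sup>+s. ?f t s \<partial>max_law G) \<in> borel_measurable borel"
      unfolding g(2) by (subst nn_integral_density) measurable
  qed
  finally show ?thesis .
qed

theorem theorem3p2: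
  fixes G H :: "'a graph" and c :: real
  assumes "simple_graph G" and "simple_graph H"
    and "verts G \<inter> verts H = {}"
    and "c \<in> {0..1}"
  shows "vol (graph_join G H) c =
    (LINT t:{0..c}|lborel. (LINT s:{0..c}|lborel. vol_deriv G s * vol_deriv H t * K s t))"
proof -
  obtain g where [measurable]: "g \<in> borel_measurable borel" and g0: "\<And>s. g s \<ge> 0"
    and gd: "\<And>s. s \<in> {0<..<1} - {1/2} \<Longrightarrow> vol_deriv G s = g s"
    and gl: "max_law G = density lborel (\<lambda>s. indicator {0..1} s * ennreal (g s))"
    using vol_deriv_density[OF assms(1)] by blast
  obtain h where [measurable]: "h \<in> borel_measurable borel" and h0: "\<And>s. h s \<ge> 0"
    and hd: "\<And>s. s \<in> {0<..<1} - {1/2} \<Longrightarrow> vol_deriv H s = h s"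
    and hl: "max_law H = density lborel (\<lambda>s. indicator {0..1} s * ennreal (h s))"
    using vol_deriv_density[OF assms(2)] by blast
  have c: "0 \<le> c" "c \<le> 1" using assms(4) by auto
  have K0: "K s t \<ge> 0" and K1: "K s t \<le> 1" for s t by (auto simp: K_def)
  let ?F = "\<lambda>t s. indicator {0..c} s * (g s * h t * K s t)"
  define I where "I t = (\<integral>\<^sup>+s. ennreal (?F t s) \<partial>lborel)" for t
  have Im [measurable]: "I \<in> borel_measurable borel" unfolding I_def by measurable
  \<comment> \<open>\<open>enn2real\<close> sends infinity to 0, so the inner integral must be
    finite before it can be passed through. As K <= 1, it is at most \<open>h t\<close> times the
    total mass of \<open>max_law G\<close>.\<close>
  have Ifin: "I t < \<infinity>" for t
  proof -
    have "I t \<le> (\<integral>\<^sup>+s. ennreal (h t) * (indicator {0..1} s * ennreal (g s)) \<partial>lborel)"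
      unfolding I_def using c g0 h0 K0 K1
      by (intro nn_integral_mono)
        (auto simp: indicator_def ennreal_mult[symmetric] mult_left_le mult_ac intro!: ennreal_leI mult_left_mono)
    also have "\<dots> = ennreal (h t) * emeasure (max_law G) UNIV"
      by (simp add: nn_integral_cmult gl emeasure_density)
    also have "\<dots> < \<infinity>"
      by (simp add: emeasure_max_law_UNIV[OF assms(1)] ennreal_mult_less_top)
    finally show ?thesis .
  qed
  have inner: "(LINT s:{0..c}|lborel. g s * h t * K s t) = enn2real (I t)" for t
    unfolding set_lebesgue_integral_def I_def using g0 h0 K0
    by (subst integral_eq_nn_integral) auto
  \<comment> \<open>Integrands that agree off a countable null set have the same integral, with no
    measurability of \<open>vol_deriv\<close> required. This is used in t, and again in s for fixed
    t.\<close>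
  have "(LINT t:{0..c}|lborel. (LINT s:{0..c}|lborel. vol_deriv G s * vol_deriv H t * K s t)) =
    (LINT t:{0..c}|lborel. (LINT s:{0..c}|lborel. g s * h t * K s t))"
    unfolding set_lebesgue_integral_def
  proof (rule integral_discrete_difference[where X="{0, 1/2, 1}"])
    fix t :: real assume t: "t \<notin> {0, 1/2, 1}"
    show "indicator {0..c} t *\<^sub>R (LINT s|lborel. indicator {0..c} s *\<^sub>R (vol_deriv G s * vol_deriv H t * K s t)) =
      indicator {0..c} t *\<^sub>R (LINT s|lborel. indicator {0..c} s *\<^sub>R (g s * h t * K s t))"
    proof (cases "t \<in> {0..c}")
      case True
      with t c have "vol_deriv H t = h t" by (intro hd) auto
      moreover have "(LINT s|lborel. indicator {0..c} s *\<^sub>R (vol_deriv G s * h t * K s t)) =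
          (LINT s|lborel. indicator {0..c} s *\<^sub>R (g s * h t * K s t))"
        by (rule integral_discrete_difference[where X="{0, 1/2, 1}"])
          (use c gd in \<open>auto simp: indicator_def\<close>)
      ultimately show ?thesis by simp
    qed simp
  qed auto
  also have "\<dots> = (LINT t:{0..c}|lborel. enn2real (I t))"
    by (simp add: inner)
  also have "\<dots> = enn2real (\<integral>\<^sup>+t. indicator {0..c} t * I t \<partial>lborel)"
    unfolding set_lebesgue_integral_def using Ifin
    by (subst integral_eq_nn_integral)
      (auto simp: ennreal_mult'' ennreal_indicator intro!: arg_cong[where f=enn2real] nn_integral_cong)
  also have "(\<integral>\<^sup>+t. indicator {0..c} t * I t \<partial>lborel) = ennreal (vol (graph_join G H) c)"
  proof -
    let ?f = "\<lambda>t s. indicator {..c} t * indicator {..c} s * ennreal (K s t)"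
    have "ennreal (vol (graph_join G H) c) = (\<integral>\<^sup>+t. (\<integral>\<^sup>+s. ?f t s \<partial>max_law G) \<partial>max_law H)"
      using assms(1-3) c(2) by (rule vol_join)
    also have "\<dots> = (\<integral>\<^sup>+t. indicator {0..1} t * ennreal (h t) *
        (\<integral>\<^sup>+s. indicator {0..1} s * ennreal (g s) * ?f t s \<partial>lborel) \<partial>lborel)"
      unfolding gl hl by (simp add: nn_integral_density)
    also have "\<dots> = (\<integral>\<^sup>+t. indicator {0..c} t * I t \<partial>lborel)"
    proof (intro nn_integral_cong)
      fix t :: real
      have "indicator {0..1} t * ennreal (h t) * (\<integral>\<^sup>+s. indicator {0..1} s * ennreal (g s) * ?f t s \<partial>lborel)
        = (\<integral>\<^sup>+s. indicator {0..1} t * ennreal (h t) * (indicator {0..1} s * ennreal (g s) * ?f t s) \<partial>lborel)"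
        by (rule nn_integral_cmult[symmetric]) measurable
      also have "\<dots> = (\<integral>\<^sup>+s. indicator {0..c} t * ennreal (?F t s) \<partial>lborel)"
        \<comment> \<open>Since 0 <= c <= 1, restricting the half-line \<open>{..c}\<close> to the
          unit interval gives \<open>{0..c}\<close> in each variable.\<close>
        using c g0 h0 K0
        by (intro nn_integral_cong) (auto simp: indicator_def ennreal_mult mult_ac)
      also have "\<dots> = indicator {0..c} t * I t"
        unfolding I_def by (rule nn_integral_cmult) measurable
      finally show "indicator {0..1} t * ennreal (h t) *
        (\<integral>\<^sup>+s. indicator {0..1} s * ennreal (g s) * ?f t s \<partial>lborel) = indicator {0..c} t * I t" .
    qed
    finally show ?thesis by simp
  qed
  finally show ?thesis
    using vol_nonneg[OF simple_graph_join[OF assms(1-3)]] by simp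
qed

end
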